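(* Let $\mathbf{A}$ be an Epistemic BL-algebra. If $F$ is an epistemic BL-filter of $\mathbf{A}$, then the relation $\equiv_F$ defined by $a\equiv_F b$ iff $a\to b\in F$ and $b\to a\in F$ is a congruence of $\mathbf{A}$ (as an algebra with operations $\vee,\wedge,\ast,\to,\forall,\exists,0,1$), and $F=\{a\in A: a\equiv_F 1\}$. Conversely, if $\equiv$ is a congruence of $\mathbf{A}$, then $F_\equiv=\{a\in A: a\equiv 1\}$ is an epistemic BL-filter, and $a\equiv b$ iff $a\to b\equiv 1$ and $b\to a\equiv 1$. Consequently, $F\mapsto\equiv_F$ is a bijection from the set of epistemic BL-filters of $\mathbf{A}$ onto the set of congruences of $\mathbf{A}$.
   Context: A BL-algebra is an algebra $\langle A,\wedge,\vee,\ast,\to,0,1\rangle$ such that $\langle A,\wedge,\vee,0,1\rangle$ is a bounded lattice (with order $\le$), $\langle A,\ast,1\rangle$ is a commutative monoid, $a\ast b\le c$ iff $a\le b\to c$ for all $a,b,c$, and the identities $a\wedge b=a\ast(a\to b)$ and $(a\to b)\vee(b\to a)=1$ hold. An Epistemic BL-algebra (EBL-algebra) is an algebra $\langle A,\vee,\wedge,\ast,\to,\forall,\exists,0,1\rangle$ whose reduct is a BL-algebra and where $\forall,\exists$ are unary operations satisfying, for all $a,b$: (E$\forall$) $\forall 1=1$; (E$\exists$) $\exists 0=0$; (E1) $\forall a\to\exists a=1$; (E2) $\forall(a\to\forall b)=\exists a\to\forall b$; (E3) $\forall(\forall a\to b)=\forall a\to\forall b$; (E4) $\exists a\to\forall\exists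 a=1$; (E4a) $\forall(a\wedge b)=\forall a\wedge\forall b$; (E4b) $\exists(a\vee b)=\exists a\vee\exists b$; (E5) $\exists(a\ast\exists b)=\exists a\ast\exists b$. An implicative filter of a BL-algebra is a subset $F$ with $1\in F$ such that $x\in F$ and $x\to y\in F$ imply $y\in F$. An epistemic BL-filter of an EBL-algebra is an implicative filter $F$ of its BL-reduct such that whenever $a\to b\in F$, also $\forall a\to\forall b\in F$ and $\exists a\to\exists b\in F$. *)

theory Defs
  imports "HOL-Algebra.Group"
begin

text \<open>The product \<open>\<otimes>\<close> and the top element \<open>\<one>\<close> are the operations of the underlying
  monoid record.\<close>

record 'a bl = "'a monoid" +
  bl_meet :: "['a, 'a] \<Rightarrow> 'a"  (infixl \<open>\<curlywedge>\<index>\<close> 70)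
  bl_join :: "['a, 'a] \<Rightarrow> 'a"  (infixl \<open>\<curlyvee>\<index>\<close> 65)
  bl_imp  :: "['a, 'a] \<Rightarrow> 'a"  (infixr \<open>\<rightharpoonup>\<index>\<close> 60)
  bl_zero :: 'a  (\<open>\<zero>\<index>\<close>)

record 'a ebl = "'a bl" +
  ebl_all :: "'a \<Rightarrow> 'a"  (\<open>\<box>\<index> _\<close> [81] 80)
  ebl_ex  :: "'a \<Rightarrow> 'a"  (\<open>\<diamond>\<index> _\<close> [81] 80)

definition bl_le :: "('a, 'm) bl_scheme \<Rightarrow> 'a \<Rightarrow> 'a \<Rightarrow> bool"  (infixl \<open>\<preceq>\<index>\<close> 50)
  where "a \<preceq>\<^bsub>A\<^esub> b \<longleftrightarrow> a \<curlywedge>\<^bsub>A\<^esub> b = a"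

locale bl_algebra = comm_monoid A for A (structure) +
  assumes meet_closed: "\<lbrakk>a \<in> carrier A; b \<in> carrier A\<rbrakk> \<Longrightarrow> a \<curlywedge> b \<in> carrier A"
    and join_closed: "\<lbrakk>a \<in> carrier A; b \<in> carrier A\<rbrakk> \<Longrightarrow> a \<curlyvee> b \<in> carrier A"
    and imp_closed: "\<lbrakk>a \<in> carrier A; b \<in> carrier A\<rbrakk> \<Longrightarrow> a \<rightharpoonup> b \<in> carrier A"
    and zero_closed: "\<zero> \<in> carrier A"
    and meet_comm: "\<lbrakk>a \<in> carrier A; b \<in> carrier A\<rbrakk> \<Longrightarrow> a \<curlywedge> b = b \<curlywedge> a"
    and join_comm: "\<lbrakk>a \<in> carrier A; b \<in> carrier A\<rbrakk> \<Longrightarrow> a \<curlyvee> b = b \<curlyvee> a"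
    and meet_assoc: "\<lbrakk>a \<in> carrier A; b \<in> carrier A; c \<in> carrier A\<rbrakk>
          \<Longrightarrow> (a \<curlywedge> b) \<curlywedge> c = a \<curlywedge> (b \<curlywedge> c)"
    and join_assoc: "\<lbrakk>a \<in> carrier A; b \<in> carrier A; c \<in> carrier A\<rbrakk>
          \<Longrightarrow> (a \<curlyvee> b) \<curlyvee> c = a \<curlyvee> (b \<curlyvee> c)"
    and meet_absorb: "\<lbrakk>a \<in> carrier A; b \<in> carrier A\<rbrakk> \<Longrightarrow> a \<curlywedge> (a \<curlyvee> b) = a"
    and join_absorb: "\<lbrakk>a \<in> carrier A; b \<in> carrier A\<rbrakk> \<Longrightarrow> a \<curlyvee> (a \<curlywedge> b) = a"
    and zero_least: "a \<in> carrier A \<Longrightarrow> \<zero> \<preceq> a"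
    and one_greatest: "a \<in> carrier A \<Longrightarrow> a \<preceq> \<one>"
    and residuation: "\<lbrakk>a \<in> carrier A; b \<in> carrier A; c \<in> carrier A\<rbrakk>
          \<Longrightarrow> a \<otimes> b \<preceq> c \<longleftrightarrow> a \<preceq> (b \<rightharpoonup> c)"
    and divisibility: "\<lbrakk>a \<in> carrier A; b \<in> carrier A\<rbrakk> \<Longrightarrow> a \<curlywedge> b = a \<otimes> (a \<rightharpoonup> b)"
    and prelinearity: "\<lbrakk>a \<in> carrier A; b \<in> carrier A\<rbrakk> \<Longrightarrow> (a \<rightharpoonup> b) \<curlyvee> (b \<rightharpoonup> a) = \<one>"

text \<open>\<open>\<box>\<close> and \<open>\<diamond>\<close> stand for the unary operations usually written \<open>\<forall>\<close> and \<open>\<exists>\<close>.\<close>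

locale ebl_algebra = bl_algebra A for A (structure) +
  assumes all_closed: "a \<in> carrier A \<Longrightarrow> \<box> a \<in> carrier A"
    and ex_closed: "a \<in> carrier A \<Longrightarrow> \<diamond> a \<in> carrier A"
    and E_all: "\<box> \<one> = \<one>"
    and E_ex: "\<diamond> \<zero> = \<zero>"
    and E1: "a \<in> carrier A \<Longrightarrow> \<box> a \<rightharpoonup> \<diamond> a = \<one>"
    and E2: "\<lbrakk>a \<in> carrier A; b \<in> carrier A\<rbrakk> \<Longrightarrow> \<box> (a \<rightharpoonup> \<box> b) = \<diamond> a \<rightharpoonup> \<box> b"
    and E3: "\<lbrakk>a \<in> carrier A; b \<in> carrier A\<rbrakk> \<Longrightarrow> \<box> (\<box> a \<rightharpoonup> b) = \<box> a \<rightharpoonup> \<box> b"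
    and E4: "a \<in> carrier A \<Longrightarrow> \<diamond> a \<rightharpoonup> \<box> (\<diamond> a) = \<one>"
    and E4a: "\<lbrakk>a \<in> carrier A; b \<in> carrier A\<rbrakk> \<Longrightarrow> \<box> (a \<curlywedge> b) = \<box> a \<curlywedge> \<box> b"
    and E4b: "\<lbrakk>a \<in> carrier A; b \<in> carrier A\<rbrakk> \<Longrightarrow> \<diamond> (a \<curlyvee> b) = \<diamond> a \<curlyvee> \<diamond> b"
    and E5: "\<lbrakk>a \<in> carrier A; b \<in> carrier A\<rbrakk> \<Longrightarrow> \<diamond> (a \<otimes> \<diamond> b) = \<diamond> a \<otimes> \<diamond> b"

definition implicative_filter :: "('a, 'm) bl_scheme \<Rightarrow> 'a set \<Rightarrow> bool"
  where "implicative_filter A F \<longleftrightarrow>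
    F \<subseteq> carrier A \<and> \<one>\<^bsub>A\<^esub> \<in> F \<and>
    (\<forall>x\<in>carrier A. \<forall>y\<in>carrier A. x \<in> F \<longrightarrow> x \<rightharpoonup>\<^bsub>A\<^esub> y \<in> F \<longrightarrow> y \<in> F)"

definition epistemic_filter :: "('a, 'm) ebl_scheme \<Rightarrow> 'a set \<Rightarrow> bool"
  where "epistemic_filter A F \<longleftrightarrow>
    implicative_filter A F \<and>
    (\<forall>a\<in>carrier A. \<forall>b\<in>carrier A. a \<rightharpoonup>\<^bsub>A\<^esub> b \<in> F \<longrightarrow>
       \<box>\<^bsub>A\<^esub> a \<rightharpoonup>\<^bsub>A\<^esub> \<box>\<^bsub>A\<^esub> b \<in> F \<and> \<diamond>\<^bsub>A\<^esub> a \<rightharpoonup>\<^bsub>A\<^esub> \<diamond>\<^bsub>A\<^esub> b \<in> F)"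

text \<open>Compatibility with the constants \<open>\<zero>\<close> and \<open>\<one>\<close> is reflexivity.\<close>

definition ebl_congruence :: "('a, 'm) ebl_scheme \<Rightarrow> ('a \<times> 'a) set \<Rightarrow> bool"
  where "ebl_congruence A r \<longleftrightarrow>
    equiv (carrier A) r \<and>
    (\<forall>a a' b b'. (a, a') \<in> r \<longrightarrow> (b, b') \<in> r \<longrightarrow>
       (a \<curlyvee>\<^bsub>A\<^esub> b, a' \<curlyvee>\<^bsub>A\<^esub> b') \<in> r \<and>
       (a \<curlywedge>\<^bsub>A\<^esub> b, a' \<curlywedge>\<^bsub>A\<^esub> b') \<in> r \<and>
       (a \<otimes>\<^bsub>A\<^esub> b, a' \<otimes>\<^bsub>A\<^esub> b') \<in> r \<and>
       (a \<rightharpoonup>\<^bsub>A\<^esub> b, a' \<rightharpoonup>\<^bsub>A\<^esub> b') \<in> r) \<and>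
    (\<forall>a a'. (a, a') \<in> r \<longrightarrow> (\<box>\<^bsub>A\<^esub> a, \<box>\<^bsub>A\<^esub> a') \<in> r \<and> (\<diamond>\<^bsub>A\<^esub> a, \<diamond>\<^bsub>A\<^esub> a') \<in> r)"

definition filter_rel :: "('a, 'm) bl_scheme \<Rightarrow> 'a set \<Rightarrow> ('a \<times> 'a) set"
  where "filter_rel A F =
    {(a, b). a \<in> carrier A \<and> b \<in> carrier A \<and> a \<rightharpoonup>\<^bsub>A\<^esub> b \<in> F \<and> b \<rightharpoonup>\<^bsub>A\<^esub> a \<in> F}"

definition unit_class :: "('a, 'm) bl_scheme \<Rightarrow> ('a \<times> 'a) set \<Rightarrow> 'a set"
  where "unit_class A r = {a \<in> carrier A. (a, \<one>\<^bsub>A\<^esub>) \<in> r}"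

end

theory Submission
  imports Defs
begin

text \<open>Residuation makes every operation of a BL-algebra monotone or antitone relative to an
  implicative filter: \<open>a \<rightharpoonup> b\<close> lies below \<open>a \<circ> c \<rightharpoonup> b \<circ> c\<close> for each lattice or monoid
  operation \<open>\<circ>\<close>, and likewise for \<open>\<rightharpoonup>\<close> in each argument. Hence \<open>a \<rightharpoonup> b \<in> F\<close> is a compatible
  preorder, and its symmetric part is a congruence. Conversely, if \<open>a \<rightharpoonup> b \<equiv> \<one>\<close>, then
  divisibility gives \<open>a \<curlywedge> b \<equiv> a\<close> and absorption gives \<open>a \<curlyvee> b \<equiv> b\<close>; since \<open>\<box>\<close> preserves meets
  and \<open>\<diamond>\<close> preserves joins, the unit class is closed under the two epistemic rules.\<close>

section \<open>Order and residuation in a BL-algebra\<close>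

context bl_algebra
begin

lemmas bl_closed = meet_closed join_closed imp_closed zero_closed

lemma meet_idem: "a \<in> carrier A \<Longrightarrow> a \<curlywedge> a = a"
  by (metis join_absorb meet_absorb meet_closed)

lemma le_refl: "a \<in> carrier A \<Longrightarrow> a \<preceq> a"
  by (simp add: bl_le_def meet_idem)

lemma le_trans:
  "\<lbrakk>a \<preceq> b; b \<preceq> c; a \<in> carrier A; b \<in> carrier A; c \<in> carrier A\<rbrakk> \<Longrightarrow> a \<preceq> c"
  unfolding bl_le_def by (metis meet_assoc)

lemma le_antisym: "\<lbrakk>a \<preceq> b; b \<preceq> a; a \<in> carrier A; b \<in> carrier A\<rbrakk> \<Longrightarrow> a = b"
  unfolding bl_le_def by (metis meet_comm)

lemma meet_le1: "\<lbrakk>a \<in> carrier A; b \<in> carrier A\<rbrakk> \<Longrightarrow> a \<curlywedge> b \<preceq> a"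
  unfolding bl_le_def by (metis meet_assoc meet_comm meet_idem)

lemma meet_le2: "\<lbrakk>a \<in> carrier A; b \<in> carrier A\<rbrakk> \<Longrightarrow> a \<curlywedge> b \<preceq> b"
  by (metis meet_comm meet_le1)

lemma meet_greatest:
  "\<lbrakk>c \<preceq> a; c \<preceq> b; a \<in> carrier A; b \<in> carrier A; c \<in> carrier A\<rbrakk> \<Longrightarrow> c \<preceq> a \<curlywedge> b"
  unfolding bl_le_def by (metis meet_assoc)

lemma le_iff_join: "\<lbrakk>a \<in> carrier A; b \<in> carrier A\<rbrakk> \<Longrightarrow> a \<preceq> b \<longleftrightarrow> a \<curlyvee> b = b"
  unfolding bl_le_def by (metis join_absorb join_comm meet_absorb meet_comm)

lemma join_ge1: "\<lbrakk>a \<in> carrier A; b \<in> carrier A\<rbrakk> \<Longrightarrow> a \<preceq> a \<curlyvee> b"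
  unfolding bl_le_def by (rule meet_absorb)

lemma join_ge2: "\<lbrakk>a \<in> carrier A; b \<in> carrier A\<rbrakk> \<Longrightarrow> b \<preceq> a \<curlyvee> b"
  by (metis join_comm join_ge1)

lemma join_least:
  "\<lbrakk>a \<preceq> c; b \<preceq> c; a \<in> carrier A; b \<in> carrier A; c \<in> carrier A\<rbrakk> \<Longrightarrow> a \<curlyvee> b \<preceq> c"
  by (simp add: le_iff_join join_closed join_assoc)

text \<open>Residuation with left factor \<open>\<one>\<close>:
  \<open>\<one> \<otimes> a \<preceq> b\<close> iff
  \<open>\<one> \<preceq> a \<rightharpoonup> b\<close>, and only \<open>\<one>\<close> lies above
  \<open>\<one>\<close>.\<close>

lemma le_iff_imp: "\<lbrakk>a \<in> carrier A; b \<in> carrier A\<rbrakk> \<Longrightarrow> a \<preceq> b \<longleftrightarrow> a \<rightharpoonup> b = \<one>"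
  by (metis imp_closed l_one le_antisym le_refl one_closed one_greatest residuation)

lemma imp_mult_le: "\<lbrakk>a \<in> carrier A; b \<in> carrier A\<rbrakk> \<Longrightarrow> (a \<rightharpoonup> b) \<otimes> a \<preceq> b"
  by (simp add: residuation imp_closed le_refl)

lemma mult_mono_left:
  assumes "a \<preceq> b" "a \<in> carrier A" "b \<in> carrier A" "c \<in> carrier A"
  shows "a \<otimes> c \<preceq> b \<otimes> c"
proof -
  \<comment> \<open>The unit of the adjunction between product and implication.\<close>
  have "b \<preceq> c \<rightharpoonup> b \<otimes> c"
    using assms by (metis le_refl m_closed residuation)
  then have "a \<preceq> c \<rightharpoonup> b \<otimes> c"
    using assms le_trans[of a b "c \<rightharpoonup> b \<otimes> c"] by (simp add: imp_closed)
  then show ?thesis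
    using assms by (simp add: residuation)
qed

lemma mult_mono_right:
  "\<lbrakk>a \<preceq> b; a \<in> carrier A; b \<in> carrier A; c \<in> carrier A\<rbrakk> \<Longrightarrow> c \<otimes> a \<preceq> c \<otimes> b"
  by (metis m_comm mult_mono_left)

lemma mult_le2:
  assumes "a \<in> carrier A" "b \<in> carrier A"
  shows "a \<otimes> b \<preceq> b"
  using mult_mono_left[OF one_greatest[OF assms(1)] assms(1) one_closed assms(2)] assms by simp

text \<open>By residuation it suffices to multiply
  \<open>(a \<rightharpoonup> b) \<otimes> a \<preceq> b\<close> by \<open>c\<close>.\<close>

lemma imp_le_imp_mult:
  assumes "a \<in> carrier A" "b \<in> carrier A" "c \<in> carrier A"
  shows "a \<rightharpoonup> b \<preceq> a \<otimes> c \<rightharpoonup> b \<otimes> c"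
proof -
  have "((a \<rightharpoonup> b) \<otimes> a) \<otimes> c \<preceq> b \<otimes> c"
    using assms by (intro mult_mono_left imp_mult_le) (simp_all add: imp_closed)
  then show ?thesis
    using assms by (simp add: m_assoc imp_closed flip: residuation)
qed

text \<open>The product of \<open>a \<rightharpoonup> b\<close> with
  \<open>a \<curlywedge> c\<close> lies below \<open>b\<close> by way of \<open>a\<close>, and below
  \<open>c\<close> because a product lies below its factors.\<close>

lemma imp_le_imp_meet:
  assumes "a \<in> carrier A" "b \<in> carrier A" "c \<in> carrier A"
  shows "a \<rightharpoonup> b \<preceq> a \<curlywedge> c \<rightharpoonup> b \<curlywedge> c"
proof -
  note [simp] = assms bl_closed
  have "(a \<rightharpoonup> b) \<otimes> (a \<curlywedge> c) \<preceq> (a \<rightharpoonup> b) \<otimes> a"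
    by (intro mult_mono_right meet_le1) simp_all
  then have "(a \<rightharpoonup> b) \<otimes> (a \<curlywedge> c) \<preceq> b"
    by (rule le_trans[OF _ imp_mult_le]) simp_all
  moreover have "(a \<rightharpoonup> b) \<otimes> (a \<curlywedge> c) \<preceq> c"
    by (rule le_trans[OF mult_le2 meet_le2]) simp_all
  ultimately have "(a \<rightharpoonup> b) \<otimes> (a \<curlywedge> c) \<preceq> b \<curlywedge> c"
    by (intro meet_greatest) simp_all
  then show ?thesis
    by (simp flip: residuation)
qed

lemma imp_le_imp_join:
  assumes "a \<in> carrier A" "b \<in> carrier A" "c \<in> carrier A"
  shows "a \<rightharpoonup> b \<preceq> a \<curlyvee> c \<rightharpoonup> b \<curlyvee> c"
proof -
  note [simp] = assms bl_closed
  have "(a \<rightharpoonup> b) \<otimes> a \<preceq> b \<curlyvee> c"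
    by (rule le_trans[OF imp_mult_le join_ge1]) simp_all
  \<comment> \<open>Moving the factor \<open>a \<rightharpoonup> b\<close> to the right leaves
    \<open>a\<close> alone on the left, and likewise \<open>c\<close> below, so that
    \<open>join_least\<close> applies; distributivity of the product over joins is thereby
    avoided.\<close>
  then have "a \<preceq> (a \<rightharpoonup> b) \<rightharpoonup> (b \<curlyvee> c)"
    by (simp add: m_comm flip: residuation)
  moreover have "(a \<rightharpoonup> b) \<otimes> c \<preceq> b \<curlyvee> c"
    by (rule le_trans[OF mult_le2 join_ge2]) simp_all
  then have "c \<preceq> (a \<rightharpoonup> b) \<rightharpoonup> (b \<curlyvee> c)"
    by (simp add: m_comm flip: residuation)
  ultimately have "a \<curlyvee> c \<preceq> (a \<rightharpoonup> b) \<rightharpoonup> (b \<curlyvee> c)"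
    by (intro join_least) simp_all
  then have "(a \<rightharpoonup> b) \<otimes> (a \<curlyvee> c) \<preceq> b \<curlyvee> c"
    by (simp add: m_comm flip: residuation)
  then show ?thesis
    by (simp flip: residuation)
qed

text \<open>Two evaluations in a row: \<open>(c \<rightharpoonup> a) \<otimes> c \<preceq> a\<close>
  and \<open>(a \<rightharpoonup> b) \<otimes> a \<preceq> b\<close>.\<close>

lemma imp_le_imp_prefix:
  assumes "a \<in> carrier A" "b \<in> carrier A" "c \<in> carrier A"
  shows "a \<rightharpoonup> b \<preceq> (c \<rightharpoonup> a) \<rightharpoonup> (c \<rightharpoonup> b)"
proof -
  note [simp] = assms bl_closed
  have "(a \<rightharpoonup> b) \<otimes> ((c \<rightharpoonup> a) \<otimes> c) \<preceq> (a \<rightharpoonup> b) \<otimes> a"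
    by (intro mult_mono_right imp_mult_le) simp_all
  then have "(a \<rightharpoonup> b) \<otimes> ((c \<rightharpoonup> a) \<otimes> c) \<preceq> b"
    by (rule le_trans[OF _ imp_mult_le]) simp_all
  then show ?thesis
    by (simp add: m_assoc flip: residuation)
qed

text \<open>The prefix law for \<open>b \<rightharpoonup> c\<close>, with its two premises exchanged
  by commutativity of the product.\<close>

lemma imp_le_imp_suffix:
  assumes "a \<in> carrier A" "b \<in> carrier A" "c \<in> carrier A"
  shows "a \<rightharpoonup> b \<preceq> (b \<rightharpoonup> c) \<rightharpoonup> (a \<rightharpoonup> c)"
proof -
  note [simp] = assms bl_closed
  have "(b \<rightharpoonup> c) \<otimes> (a \<rightharpoonup> b) \<preceq> a \<rightharpoonup> c"
    using imp_le_imp_prefix[of b c a] by (simp add: residuation)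
  then show ?thesis
    by (simp add: m_comm flip: residuation)
qed

text \<open>Divisibility at \<open>\<one>\<close>: the meet of \<open>\<one>\<close> and
  \<open>a\<close> is \<open>a\<close>, and multiplying by \<open>\<one>\<close> changes
  nothing.\<close>

lemma one_imp:
  assumes "a \<in> carrier A"
  shows "\<one> \<rightharpoonup> a = a"
  using divisibility[OF one_closed assms] one_greatest[OF assms] assms
  by (simp add: bl_le_def meet_comm imp_closed)

lemma imp_one: "a \<in> carrier A \<Longrightarrow> a \<rightharpoonup> \<one> = \<one>"
  using le_iff_imp one_greatest by simp

lemma imp_refl: "a \<in> carrier A \<Longrightarrow> a \<rightharpoonup> a = \<one>"
  using le_iff_imp le_refl by simp

end

section \<open>From an implicative filter to a congruence of the BL-reduct\<close>

locale bl_filter = bl_algebra A for A (structure) and F +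
  assumes implicative_filter: "implicative_filter A F"
begin

lemma one_mem: "\<one> \<in> F"
  and mem_carrier: "x \<in> F \<Longrightarrow> x \<in> carrier A"
  and modus_ponens: "\<lbrakk>x \<in> F; x \<rightharpoonup> y \<in> F; y \<in> carrier A\<rbrakk> \<Longrightarrow> y \<in> F"
  using implicative_filter unfolding implicative_filter_def by blast+

text \<open>Turns each inequality between implications into a rule for membership in
  \<open>F\<close>: \<open>x \<preceq> y\<close> means
  \<open>x \<rightharpoonup> y = \<one>\<close>, so modus ponens applies.\<close>

lemma up_closed: "\<lbrakk>x \<in> F; x \<preceq> y; y \<in> carrier A\<rbrakk> \<Longrightarrow> y \<in> F"
  using le_iff_imp mem_carrier modus_ponens one_mem by metis

lemma imp_mem_trans:
  assumes "a \<rightharpoonup> b \<in> F" "b \<rightharpoonup> c \<in> F" "a \<in> carrier A" "b \<in> carrier A" "c \<in> carrier A"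
  shows "a \<rightharpoonup> c \<in> F"
  \<comment> \<open>The suffix inequality puts \<open>(b \<rightharpoonup> c) \<rightharpoonup> (a
    \<rightharpoonup> c)\<close> into \<open>F\<close>.\<close>
  using up_closed[OF assms(1) imp_le_imp_suffix[of a b c]] assms
  by (meson imp_closed modus_ponens)

lemma equiv_filter_rel: "equiv (carrier A) (filter_rel A F)"
proof (rule equivI)
  show "filter_rel A F \<subseteq> carrier A \<times> carrier A"
    by (auto simp: filter_rel_def)
  show "refl_on (carrier A) (filter_rel A F)"
    by (auto simp: refl_on_def filter_rel_def imp_refl one_mem)
  show "sym (filter_rel A F)"
    by (auto simp: sym_def filter_rel_def)
  show "trans (filter_rel A F)"
    unfolding trans_def filter_rel_def by (auto intro: imp_mem_trans)
qed

lemma filter_rel_trans: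
  "\<lbrakk>(a, b) \<in> filter_rel A F; (b, c) \<in> filter_rel A F\<rbrakk> \<Longrightarrow> (a, c) \<in> filter_rel A F"
  using equiv_filter_rel by (meson equiv_def transE)

lemma filter_rel_translate:
  assumes "(a, b) \<in> filter_rel A F" "c \<in> carrier A"
  shows filter_rel_join: "(a \<curlyvee> c, b \<curlyvee> c) \<in> filter_rel A F"
    and filter_rel_meet: "(a \<curlywedge> c, b \<curlywedge> c) \<in> filter_rel A F"
    and filter_rel_mult: "(a \<otimes> c, b \<otimes> c) \<in> filter_rel A F"
    and filter_rel_imp_prefix: "(c \<rightharpoonup> a, c \<rightharpoonup> b) \<in> filter_rel A F"
    and filter_rel_imp_suffix: "(a \<rightharpoonup> c, b \<rightharpoonup> c) \<in> filter_rel A F"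
  using assms unfolding filter_rel_def
  by (simp_all add: bl_closed up_closed[OF _ imp_le_imp_join] up_closed[OF _ imp_le_imp_meet]
      up_closed[OF _ imp_le_imp_mult] up_closed[OF _ imp_le_imp_prefix]
      up_closed[OF _ imp_le_imp_suffix])

text \<open>One argument is replaced at a time. Commutativity handles the second argument of the
  first three operations; implication needs the suffix and prefix laws separately.\<close>

lemma filter_rel_compatible:
  assumes r: "(a, a') \<in> filter_rel A F" "(b, b') \<in> filter_rel A F"
  shows "(a \<curlyvee> b, a' \<curlyvee> b') \<in> filter_rel A F"
    and "(a \<curlywedge> b, a' \<curlywedge> b') \<in> filter_rel A F"
    and "(a \<otimes> b, a' \<otimes> b') \<in> filter_rel A F"
    and "(a \<rightharpoonup> b, a' \<rightharpoonup> b') \<in> filter_rel A F"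
proof -
  have c: "a \<in> carrier A" "a' \<in> carrier A" "b \<in> carrier A" "b' \<in> carrier A"
    using r by (auto simp: filter_rel_def)
  show "(a \<curlyvee> b, a' \<curlyvee> b') \<in> filter_rel A F"
    using filter_rel_trans[OF filter_rel_join[OF r(1) c(3)]] filter_rel_join[OF r(2) c(2)]
    by (simp add: join_comm c)
  show "(a \<curlywedge> b, a' \<curlywedge> b') \<in> filter_rel A F"
    using filter_rel_trans[OF filter_rel_meet[OF r(1) c(3)]] filter_rel_meet[OF r(2) c(2)]
    by (simp add: meet_comm c)
  show "(a \<otimes> b, a' \<otimes> b') \<in> filter_rel A F"
    using filter_rel_trans[OF filter_rel_mult[OF r(1) c(3)]] filter_rel_mult[OF r(2) c(2)]
    by (simp add: m_comm c)
  show "(a \<rightharpoonup> b, a' \<rightharpoonup> b') \<in> filter_rel A F"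
    by (rule filter_rel_trans[OF filter_rel_imp_suffix[OF r(1) c(3)]
          filter_rel_imp_prefix[OF r(2) c(2)]])
qed

text \<open>Since \<open>a \<rightharpoonup> \<one> = \<one>\<close> and
  \<open>\<one> \<rightharpoonup> a = a\<close>, being related to \<open>\<one>\<close> amounts to
  membership in \<open>F\<close>.\<close>

lemma unit_class_filter_rel: "unit_class A (filter_rel A F) = F"
  by (auto simp: unit_class_def filter_rel_def one_imp imp_one one_mem mem_carrier)

end

section \<open>Compatibility with the epistemic operators\<close>

context ebl_algebra
begin

lemma epistemic_filter_imp_bl_filter: "epistemic_filter A F \<Longrightarrow> bl_filter A F"
  by unfold_locales (simp add: epistemic_filter_def)

lemma unit_class_filter_rel:
  "epistemic_filter A F \<Longrightarrow> unit_class A (filter_rel A F) = F"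
  by (rule bl_filter.unit_class_filter_rel[OF epistemic_filter_imp_bl_filter])

lemma ebl_congruence_filter_rel:
  assumes "epistemic_filter A F"
  shows "ebl_congruence A (filter_rel A F)"
proof -
  interpret bl_filter A F
    using assms by (rule epistemic_filter_imp_bl_filter)
  have "(\<box> a, \<box> a') \<in> filter_rel A F \<and> (\<diamond> a, \<diamond> a') \<in> filter_rel A F"
    if "(a, a') \<in> filter_rel A F" for a a'
    using that assms
    unfolding epistemic_filter_def filter_rel_def by (simp add: all_closed ex_closed)
  then show ?thesis
    unfolding ebl_congruence_def by (simp add: equiv_filter_rel filter_rel_compatible)
qed

end

section \<open>From a congruence to an epistemic filter\<close>

locale ebl_cong = ebl_algebra A for A (structure) and r +
  assumes congruence: "ebl_congruence A r"
begin

lemma cong_carrier: "(a, b) \<in> r \<Longrightarrow> a \<in> carrier A \<and> b \<in> carrier A"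
  and cong_refl: "a \<in> carrier A \<Longrightarrow> (a, a) \<in> r"
  and cong_sym: "(a, b) \<in> r \<Longrightarrow> (b, a) \<in> r"
  and cong_trans: "\<lbrakk>(a, b) \<in> r; (b, c) \<in> r\<rbrakk> \<Longrightarrow> (a, c) \<in> r"
proof -
  have eq: "equiv (carrier A) r"
    using congruence by (simp add: ebl_congruence_def)
  show "(a, b) \<in> r \<Longrightarrow> a \<in> carrier A \<and> b \<in> carrier A"
    using equiv_type[OF eq] by blast
  show "a \<in> carrier A \<Longrightarrow> (a, a) \<in> r"
    using eq by (simp add: equiv_def refl_on_def)
  show "(a, b) \<in> r \<Longrightarrow> (b, a) \<in> r"
    using eq by (meson equiv_def symD)
  show "\<lbrakk>(a, b) \<in> r; (b, c) \<in> r\<rbrakk> \<Longrightarrow> (a, c) \<in> r"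
    using eq by (meson equiv_def transD)
qed

lemma cong_join: "\<lbrakk>(a, a') \<in> r; (b, b') \<in> r\<rbrakk> \<Longrightarrow> (a \<curlyvee> b, a' \<curlyvee> b') \<in> r"
  and cong_mult: "\<lbrakk>(a, a') \<in> r; (b, b') \<in> r\<rbrakk> \<Longrightarrow> (a \<otimes> b, a' \<otimes> b') \<in> r"
  and cong_imp: "\<lbrakk>(a, a') \<in> r; (b, b') \<in> r\<rbrakk> \<Longrightarrow> (a \<rightharpoonup> b, a' \<rightharpoonup> b') \<in> r"
  and cong_all: "(a, a') \<in> r \<Longrightarrow> (\<box> a, \<box> a') \<in> r"
  and cong_ex: "(a, a') \<in> r \<Longrightarrow> (\<diamond> a, \<diamond> a') \<in> r"
  using congruence unfolding ebl_congruence_def by blast+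

text \<open>Multiplying the hypothesis by \<open>a\<close> gives
  \<open>a \<otimes> (a \<rightharpoonup> b)\<close> on the left, which is the meet by divisibility,
  and \<open>a\<close> on the right.\<close>

lemma imp_cong_one_imp_meet:
  assumes "(a \<rightharpoonup> b, \<one>) \<in> r" "a \<in> carrier A" "b \<in> carrier A"
  shows "(a \<curlywedge> b, a) \<in> r"
  using cong_mult[OF cong_refl[OF assms(2)] assms(1)] assms by (simp add: divisibility)

text \<open>Joining the previous congruence with \<open>b\<close> collapses its left side by
  absorption.\<close>

lemma imp_cong_one_imp_join:
  assumes "(a \<rightharpoonup> b, \<one>) \<in> r" "a \<in> carrier A" "b \<in> carrier A"
  shows "(b, a \<curlyvee> b) \<in> r"
proof -
  have "b \<curlyvee> (a \<curlywedge> b) = b"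
    using assms join_absorb[of b a] by (simp add: meet_comm)
  then show ?thesis
    using cong_join[OF cong_refl[OF assms(3)] imp_cong_one_imp_meet[OF assms]] assms
    by (simp add: join_comm)
qed

lemma cong_iff_imp:
  assumes "a \<in> carrier A" "b \<in> carrier A"
  shows "(a, b) \<in> r \<longleftrightarrow> (a \<rightharpoonup> b, \<one>) \<in> r \<and> (b \<rightharpoonup> a, \<one>) \<in> r"
proof
  assume "(a, b) \<in> r"
  from cong_imp[OF this cong_refl[OF assms(2)]] cong_imp[OF cong_refl[OF assms(2)] this]
  show "(a \<rightharpoonup> b, \<one>) \<in> r \<and> (b \<rightharpoonup> a, \<one>) \<in> r"
    using assms by (simp add: imp_refl)
next
  assume "(a \<rightharpoonup> b, \<one>) \<in> r \<and> (b \<rightharpoonup> a, \<one>) \<in> r"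
  then show "(a, b) \<in> r"
    \<comment> \<open>Both \<open>a\<close> and \<open>b\<close> are congruent to their common
      meet.\<close>
    using assms imp_cong_one_imp_meet[of a b] imp_cong_one_imp_meet[of b a]
    by (metis cong_sym cong_trans meet_comm)
qed

lemma filter_rel_unit_class: "filter_rel A (unit_class A r) = r"
proof -
  have "(a, b) \<in> filter_rel A (unit_class A r) \<longleftrightarrow> (a, b) \<in> r" for a b
    unfolding filter_rel_def unit_class_def
    using cong_iff_imp[of a b] cong_carrier[of a b] imp_closed by blast
  then show ?thesis by auto
qed

lemma all_imp_cong_one:
  assumes "(a \<rightharpoonup> b, \<one>) \<in> r" "a \<in> carrier A" "b \<in> carrier A"
  shows "(\<box> a \<rightharpoonup> \<box> b, \<one>) \<in> r"
proof -
  note [simp] = assms(2,3) all_closed bl_closed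
  \<comment> \<open>\<open>E4a\<close> splits \<open>\<box> (a \<curlywedge> b)\<close>. Replacing
    \<open>\<box> a\<close> by this meet turns the implication into one that holds in the
    order.\<close>
  have "(\<box> a, \<box> a \<curlywedge> \<box> b) \<in> r"
    using cong_sym[OF cong_all[OF imp_cong_one_imp_meet[OF assms]]] by (simp add: E4a)
  then have "(\<box> a \<rightharpoonup> \<box> b, \<box> a \<curlywedge> \<box> b \<rightharpoonup> \<box> b) \<in> r"
    by (intro cong_imp cong_refl) simp_all
  moreover have "\<box> a \<curlywedge> \<box> b \<rightharpoonup> \<box> b = \<one>"
    by (simp add: meet_le2 flip: le_iff_imp)
  ultimately show ?thesis by simp
qed

lemma ex_imp_cong_one:
  assumes "(a \<rightharpoonup> b, \<one>) \<in> r" "a \<in> carrier A" "b \<in> carrier A"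
  shows "(\<diamond> a \<rightharpoonup> \<diamond> b, \<one>) \<in> r"
proof -
  note [simp] = assms(2,3) ex_closed bl_closed
  \<comment> \<open>Dually, \<open>E4b\<close> splits the join, and it is the conclusion
    \<open>\<diamond> b\<close> that gets replaced.\<close>
  have "(\<diamond> b, \<diamond> a \<curlyvee> \<diamond> b) \<in> r"
    using cong_ex[OF imp_cong_one_imp_join[OF assms]] by (simp add: E4b)
  then have "(\<diamond> a \<rightharpoonup> \<diamond> b, \<diamond> a \<rightharpoonup> \<diamond> a \<curlyvee> \<diamond> b) \<in> r"
    by (intro cong_imp cong_refl) simp_all
  moreover have "\<diamond> a \<rightharpoonup> \<diamond> a \<curlyvee> \<diamond> b = \<one>"
    by (simp add: join_ge1 flip: le_iff_imp)
  ultimately show ?thesis by simp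
qed

lemma epistemic_filter_unit_class: "epistemic_filter A (unit_class A r)"
proof -
  have mp: "(y, \<one>) \<in> r" if "(x, \<one>) \<in> r" "(x \<rightharpoonup> y, \<one>) \<in> r" "y \<in> carrier A" for x y
  proof -
    \<comment> \<open>Replacing \<open>x\<close> by \<open>\<one>\<close> gives
      \<open>\<one> \<rightharpoonup> y\<close>, which equals \<open>y\<close>.\<close>
    have "(x \<rightharpoonup> y, y) \<in> r"
      using cong_imp[OF that(1) cong_refl[OF that(3)]] that(3) by (simp add: one_imp)
    then show ?thesis
      by (rule cong_trans[OF cong_sym that(2)])
  qed
  have "implicative_filter A (unit_class A r)"
    unfolding implicative_filter_def unit_class_def using mp by (blast intro: cong_refl one_closed)
  then show ?thesis
    unfolding epistemic_filter_def unit_class_def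
    by (simp add: all_closed ex_closed imp_closed all_imp_cong_one ex_imp_cong_one)
qed

end

section \<open>The correspondence between filters and congruences\<close>

theorem theorem2:
  fixes A :: "('a, 'm) ebl_scheme" (structure)
  assumes "ebl_algebra A"
  shows "(\<forall>F. epistemic_filter A F \<longrightarrow>
            ebl_congruence A (filter_rel A F) \<and> F = unit_class A (filter_rel A F)) \<and>
         (\<forall>r. ebl_congruence A r \<longrightarrow>
            epistemic_filter A (unit_class A r) \<and>
            (\<forall>a\<in>carrier A. \<forall>b\<in>carrier A.
               (a, b) \<in> r \<longleftrightarrow> (a \<rightharpoonup> b, \<one>) \<in> r \<and> (b \<rightharpoonup> a, \<one>) \<in> r)) \<and>
         bij_betw (filter_rel A) {F. epistemic_filter A F} {r. ebl_congruence A r}"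
proof -
  interpret ebl_algebra A by fact
  have cong: "ebl_cong A r" if "ebl_congruence A r" for r
    using that by unfold_locales
  have bij: "bij_betw (filter_rel A) {F. epistemic_filter A F} {r. ebl_congruence A r}"
  proof (rule bij_betw_byWitness[where f' = "unit_class A"])
    show "\<forall>F\<in>{F. epistemic_filter A F}. unit_class A (filter_rel A F) = F"
      using unit_class_filter_rel by blast
    show "\<forall>r\<in>{r. ebl_congruence A r}. filter_rel A (unit_class A r) = r"
      using ebl_cong.filter_rel_unit_class[OF cong] by blast
    show "filter_rel A ` {F. epistemic_filter A F} \<subseteq> {r. ebl_congruence A r}"
      using ebl_congruence_filter_rel by blast
    show "unit_class A ` {r. ebl_congruence A r} \<subseteq> {F. epistemic_filter A F}"
      using ebl_cong.epistemic_filter_unit_class[OF cong] by blast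
  qed
  show ?thesis
    by (intro conjI allI impI ballI bij unit_class_filter_rel[symmetric] ebl_congruence_filter_rel
        ebl_cong.epistemic_filter_unit_class[OF cong] ebl_cong.cong_iff_imp[OF cong])
qed

end
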